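(* Let $\gamma,\varepsilon,\theta_0>0$, $L>0$, let $N$ be a positive integer, $h=L/N$, and let $s>0$ be arbitrary. Let $\phi^n\in\mathcal{C}_\Omega$ satisfy discrete homogeneous Neumann boundary conditions with $-1<\phi^n<1$ pointwise, and let $\phi^{n+1},\mu^{n+1},p^{n+1}\in\mathcal{C}_\Omega$ (satisfying discrete homogeneous Neumann boundary conditions, with $-1<\phi^{n+1}<1$) and $\boldsymbol{u}^{n+1}\in\mathcal{E}_\Omega$ (satisfying discrete no-penetration and free-slip boundary conditions) be a solution of $$\phi^{n+1}-\phi^{n}=s\Delta_h\mu^{n+1}-s\nabla_h\cdot(A_h\phi^n\,\boldsymbol{u}^{n+1}),$$ $$\mu^{n+1}=\ln(1+\phi^{n+1})-\ln(1-\phi^{n+1})-\theta_0\phi^n-\varepsilon^2\Delta_h\phi^{n+1},$$ $$(-\Delta_h+I)\boldsymbol{u}^{n+1}+\nabla_h p^{n+1}+\gamma A_h\phi^n\,\nabla_h\mu^{n+1}=0,$$ $$\nabla_h\cdot\boldsymbol{u}^{n+1}=0.$$ Define the discrete energy $$F_h(\phi)=\Big((1+\phi)\ln(1+\phi)+(1-\phi)\ln(1-\phi)-\frac{\theta_0}{2}\phi^2,\,1\Big)+\frac{\varepsilon^2}{2}\|\nabla_h\phi\|_2^2.$$ Then $$F_h(\phi^{n+1})-F_h(\phi^n)\le-\frac{\varepsilon^2}{2}\|\nabla_h(\phi^{n+1}-\phi^n)\|_2^2-s\|\nabla_h\mu^{n+1}\|_2^2-\frac{s}{\gamma}\big(\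|\boldsymbol{u}^{n+1}\|_2^2+\|\nabla_h\boldsymbol{u}^{n+1}\|_2^2\big).$$
   Context: Grid functions. $\Omega=(0,L)^3$, $h=L/N$. $\mathcal{C}_\Omega$ is the set of cell-centered functions $\phi=(\phi_{i,j,k})$, $0\le i,j,k\le N+1$, with $\phi_{i,j,k}$ located at $((i-\frac12)h,(j-\frac12)h,(k-\frac12)h)$; cells with all indices in $\{1,\dots,N\}$ are interior, the others are ghost cells. $\mathcal{E}^x_\Omega$ is the set of functions $f_{i+\frac12,j,k}$, $0\le i\le N$, $1\le j,k\le N$, located at $(ih,(j-\frac12)h,(k-\frac12)h)$; $\mathcal{E}^y_\Omega,\mathcal{E}^z_\Omega$ are analogous, and $\mathcal{E}_\Omega=\mathcal{E}^x_\Omega\times\mathcal{E}^y_\Omega\times\mathcal{E}^z_\Omega$. Each component of a field in $\mathcal{E}_\Omega$ is also given ghost values (index $0$ and $N+1$) in its two tangential directions when free-slip conditions are imposed. Boundary conditions. Homogeneous Neumann for $\phi\in\mathcal{C}_\Omega$: $\phi_{0,j,k}=\phi_{1,j,k}$, $\phi_{N,j,k}=\phi_{N+1,j,k}$, and likewise in $j$ and $k$. No-penetration for $\boldsymbol{f}=(f^x,f^y,f^z)\in\mathcal{E}_\Omega$: $f^x_{1/2,j,k}=f^x_{N+1/2,j,k}=0$, and likewise for $f^y$ in $j$ and $f^z$ in $k$. Free-slip: $f^x_{i+1/2,0,k}=f^x_{i+1/2,1,k}$, $f^x_{i+1/2,N+1,k}=f^x_{i+1/2,N,k}$, $f^x_{i+1/2,j,0}=f^x_{i+1/2,j,1}$,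 $f^x_{i+1/2,j,N+1}=f^x_{i+1/2,j,N}$, and likewise for $f^y,f^z$ in their tangential directions. Operators. $d_xf_{i,j,k}=\frac1h(f_{i+\frac12,j,k}-f_{i-\frac12,j,k})$, $\nabla_h\cdot\boldsymbol{f}=d_xf^x+d_yf^y+d_zf^z$; $A_x\phi_{i+\frac12,j,k}=\frac12(\phi_{i+1,j,k}+\phi_{i,j,k})$, $A_h\phi=(A_x\phi,A_y\phi,A_z\phi)^T$; $D_x\phi_{i+\frac12,j,k}=\frac1h(\phi_{i+1,j,k}-\phi_{i,j,k})$, $\nabla_h\phi=(D_x\phi,D_y\phi,D_z\phi)^T$; $\Delta_h\phi=\nabla_h\cdot\nabla_h\phi$ for cell-centered $\phi$; on face-centered components $\Delta_h$ is the standard 7-point Laplacian on the corresponding staggered grid. Products such as $A_h\phi\,\boldsymbol{u}$ and $A_h\phi\,\nabla_h\mu$ are componentwise. Cell-centered equations hold at interior cells; the vector (Stokes) equation holds at faces not lying on $\partial\Omega$. Inner products and norms. $(\phi,\psi)=h^3\sum_{i,j,k=1}^N\phi_{i,j,k}\psi_{i,j,k}$ on $\mathcal{C}_\Omega$; $[f,g]_x=\frac12h^3\sum_{i,j,k=1}^N(f_{i+\frac12,j,k}g_{i+\frac12,j,k}+f_{i-\frac12,j,k}g_{i-\frac12,j,k})$, similarly $[\cdot,\cdot]_y,[\cdot,\cdot]_z$; $(\boldsymbol{f},\boldsymbol{g})=[f^x,g^x]_x+[f^y,g^y]_y+[f^z,g^z]_z$ and $\|\boldsymbol{f}\|_2=\sqrt{(\boldsymbol{f},\boldsymbol{f})}$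 on $\mathcal{E}_\Omega$; so $\|\nabla_h\phi\|_2^2=(\nabla_h\phi,\nabla_h\phi)$. For $\boldsymbol{u}\in\mathcal{E}_\Omega$ satisfying no-penetration and free-slip conditions, $\|\nabla_h\boldsymbol{u}\|_2^2:=-(\Delta_h\boldsymbol{u},\boldsymbol{u})$ (boundary faces contribute $0$), which equals $h^3$ times the sum of squares of all difference quotients of the components of $\boldsymbol{u}$ between neighboring grid points. *)

theory Defs
  imports "HOL-Analysis.Analysis"
begin

text \<open>
  Grid functions are total functions on \<open>nat \<times> nat \<times> nat\<close>; only the values at the indices of the
  grid in question are ever meaningful.

  A cell-centered function \<open>\<phi>\<close> uses the indices \<open>0, \<dots>, N + 1\<close>; the cells with all indices in
  \<open>{1..N}\<close> are interior, the others are ghost cells.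

  A half-integer index is stored at its floor: \<open>fx f i j k\<close> is \<open>f\<^sup>x\<close> at \<open>(i + 1/2, j, k)\<close>,
  \<open>fy f i j k\<close> is \<open>f\<^sup>y\<close> at \<open>(i, j + 1/2, k)\<close> and \<open>fz f i j k\<close> is \<open>f\<^sup>z\<close> at \<open>(i, j, k + 1/2)\<close>.
  The normal index ranges over \<open>0, \<dots>, N\<close> (\<open>0\<close> and \<open>N\<close> being the faces on the boundary of the
  domain), the tangential ones over \<open>1, \<dots>, N\<close> with ghost values at \<open>0\<close> and \<open>N + 1\<close>.
  Thus the face \<open>(i - 1/2, j, k)\<close> has first index \<open>i - 1\<close>, for \<open>i \<ge> 1\<close>.
\<close>

type_synonym grid = "nat \<Rightarrow> nat \<Rightarrow> nat \<Rightarrow> real"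

datatype face_field = Face (fx: grid) (fy: grid) (fz: grid)

definition neumann :: "nat \<Rightarrow> grid \<Rightarrow> bool" where
  "neumann N \<phi> \<longleftrightarrow> (\<forall>a\<in>{1..N}. \<forall>b\<in>{1..N}.
     \<phi> 0 a b = \<phi> 1 a b \<and> \<phi> N a b = \<phi> (N + 1) a b \<and>
     \<phi> a 0 b = \<phi> a 1 b \<and> \<phi> a N b = \<phi> a (N + 1) b \<and>
     \<phi> a b 0 = \<phi> a b 1 \<and> \<phi> a b N = \<phi> a b (N + 1))"

definition no_penetration :: "nat \<Rightarrow> face_field \<Rightarrow> bool" where
  "no_penetration N f \<longleftrightarrow> (\<forall>a\<in>{1..N}. \<forall>b\<in>{1..N}.
     fx f 0 a b = 0 \<and> fx f N a b = 0 \<and>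
     fy f a 0 b = 0 \<and> fy f a N b = 0 \<and>
     fz f a b 0 = 0 \<and> fz f a b N = 0)"

text \<open>In \<open>free_slip\<close>, \<open>m\<close> is the normal index and \<open>a\<close> the other tangential index.\<close>

definition free_slip :: "nat \<Rightarrow> face_field \<Rightarrow> bool" where
  "free_slip N f \<longleftrightarrow> (\<forall>m\<in>{0..N}. \<forall>a\<in>{1..N}.
     fx f m 0 a = fx f m 1 a \<and> fx f m (N + 1) a = fx f m N a \<and>
     fx f m a 0 = fx f m a 1 \<and> fx f m a (N + 1) = fx f m a N \<and>
     fy f 0 m a = fy f 1 m a \<and> fy f (N + 1) m a = fy f N m a \<and>
     fy f a m 0 = fy f a m 1 \<and> fy f a m (N + 1) = fy f a m N \<and>
     fz f 0 a m = fz f 1 a m \<and> fz f (N + 1) a m = fz f N a m \<and>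
     fz f a 0 m = fz f a 1 m \<and> fz f a (N + 1) m = fz f a N m)"

definition Avx :: "grid \<Rightarrow> grid" where
  "Avx \<phi> i j k = (\<phi> (i + 1) j k + \<phi> i j k) / 2"

definition Avy :: "grid \<Rightarrow> grid" where
  "Avy \<phi> i j k = (\<phi> i (j + 1) k + \<phi> i j k) / 2"

definition Avz :: "grid \<Rightarrow> grid" where
  "Avz \<phi> i j k = (\<phi> i j (k + 1) + \<phi> i j k) / 2"

definition avg :: "grid \<Rightarrow> face_field" where
  "avg \<phi> = Face (Avx \<phi>) (Avy \<phi>) (Avz \<phi>)"

definition Dx :: "real \<Rightarrow> grid \<Rightarrow> grid" where
  "Dx h \<phi> i j k = (\<phi> (i + 1) j k - \<phi> i j k) / h"

definition Dy :: "real \<Rightarrow> grid \<Rightarrow> grid" where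
  "Dy h \<phi> i j k = (\<phi> i (j + 1) k - \<phi> i j k) / h"

definition Dz :: "real \<Rightarrow> grid \<Rightarrow> grid" where
  "Dz h \<phi> i j k = (\<phi> i j (k + 1) - \<phi> i j k) / h"

definition grad :: "real \<Rightarrow> grid \<Rightarrow> face_field" where
  "grad h \<phi> = Face (Dx h \<phi>) (Dy h \<phi>) (Dz h \<phi>)"

text \<open>The divergence is meaningful at interior cells, where no natural subtraction is truncated.\<close>

definition div_h :: "real \<Rightarrow> face_field \<Rightarrow> grid" where
  "div_h h f i j k =
     (fx f i j k - fx f (i - 1) j k) / h +
     (fy f i j k - fy f i (j - 1) k) / h +
     (fz f i j k - fz f i j (k - 1)) / h"

definition lap_cell :: "real \<Rightarrow> grid \<Rightarrow> grid" where
  "lap_cell h \<phi> = div_h h (grad h \<phi>)"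

text \<open>
  In the integer indexing the 7-point stencil has the same form on the three staggered grids.
  For a face component it is meaningful at faces off the boundary, where all indices are at
  least 1.
\<close>

definition lap7 :: "real \<Rightarrow> grid \<Rightarrow> grid" where
  "lap7 h f i j k =
     (f (i + 1) j k + f (i - 1) j k + f i (j + 1) k + f i (j - 1) k
      + f i j (k + 1) + f i j (k - 1) - 6 * f i j k) / h\<^sup>2"

definition lap_face :: "real \<Rightarrow> face_field \<Rightarrow> face_field" where
  "lap_face h f = Face (lap7 h (fx f)) (lap7 h (fy f)) (lap7 h (fz f))"

definition face_mult :: "face_field \<Rightarrow> face_field \<Rightarrow> face_field" where
  "face_mult f g = Face (\<lambda>i j k. fx f i j k * fx g i j k)
                        (\<lambda>i j k. fy f i j k * fy g i j k)
                        (\<lambda>i j k. fz f i j k * fz g i j k)"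

definition cell_inner :: "real \<Rightarrow> nat \<Rightarrow> grid \<Rightarrow> grid \<Rightarrow> real" where
  "cell_inner h N \<phi> \<psi> = h ^ 3 * (\<Sum>i=1..N. \<Sum>j=1..N. \<Sum>k=1..N. \<phi> i j k * \<psi> i j k)"

definition inner_x :: "real \<Rightarrow> nat \<Rightarrow> grid \<Rightarrow> grid \<Rightarrow> real" where
  "inner_x h N f g = 1 / 2 * h ^ 3 * (\<Sum>i=1..N. \<Sum>j=1..N. \<Sum>k=1..N.
     f i j k * g i j k + f (i - 1) j k * g (i - 1) j k)"

definition inner_y :: "real \<Rightarrow> nat \<Rightarrow> grid \<Rightarrow> grid \<Rightarrow> real" where
  "inner_y h N f g = 1 / 2 * h ^ 3 * (\<Sum>i=1..N. \<Sum>j=1..N. \<Sum>k=1..N.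
     f i j k * g i j k + f i (j - 1) k * g i (j - 1) k)"

definition inner_z :: "real \<Rightarrow> nat \<Rightarrow> grid \<Rightarrow> grid \<Rightarrow> real" where
  "inner_z h N f g = 1 / 2 * h ^ 3 * (\<Sum>i=1..N. \<Sum>j=1..N. \<Sum>k=1..N.
     f i j k * g i j k + f i j (k - 1) * g i j (k - 1))"

definition face_inner :: "real \<Rightarrow> nat \<Rightarrow> face_field \<Rightarrow> face_field \<Rightarrow> real" where
  "face_inner h N f g =
     inner_x h N (fx f) (fx g) + inner_y h N (fy f) (fy g) + inner_z h N (fz f) (fz g)"

definition face_norm :: "real \<Rightarrow> nat \<Rightarrow> face_field \<Rightarrow> real" where
  "face_norm h N f = sqrt (face_inner h N f f)"

text \<open>
  \<open>grad_norm_sq h N u\<close> is \<open>\<parallel>\<nabla>\<^sub>h u\<parallel>\<^sub>2\<^sup>2\<close>, used only for \<open>u\<close> with no-penetration and free-slip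
  conditions. The boundary faces contribute 0 because \<open>u\<close> vanishes there, whatever the value of
  \<open>lap7\<close> at these faces.
\<close>

definition grad_norm_sq :: "real \<Rightarrow> nat \<Rightarrow> face_field \<Rightarrow> real" where
  "grad_norm_sq h N u = - face_inner h N (lap_face h u) u"

definition energy :: "real \<Rightarrow> real \<Rightarrow> real \<Rightarrow> nat \<Rightarrow> grid \<Rightarrow> real" where
  "energy \<epsilon> \<theta>\<^sub>0 h N \<phi> =
     cell_inner h N
       (\<lambda>i j k. (1 + \<phi> i j k) * ln (1 + \<phi> i j k) + (1 - \<phi> i j k) * ln (1 - \<phi> i j k)
                 - \<theta>\<^sub>0 / 2 * (\<phi> i j k)\<^sup>2)
       (\<lambda>i j k. 1)
     + \<epsilon>\<^sup>2 / 2 * (face_norm h N (grad h \<phi>))\<^sup>2"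

end

theory Submission
  imports Defs
begin

text \<open>
  Testing the transport equation with \<open>\<mu>\<close> and the Stokes equation with \<open>u\<close>, the coupling
  terms cancel after summation by parts, and the pressure drops out because \<open>u\<close> is
  discretely divergence-free; this evaluates \<open>(\<phi>' - \<phi>, \<mu>)\<close> as the dissipation. On the other hand
  \<open>\<mu>\<close> is the convex-concave splitting of the energy gradient: the convex logarithmic part is
  implicit, the concave quadratic part is explicit, so both are bounded by tangent lines in the
  favourable direction, while the gradient part is handled by polarization.
\<close>

section \<open>Inner products on faces\<close>

lemma sum3_rotate:
  fixes F :: grid
  shows "(\<Sum>i=1..N. \<Sum>j=1..N. \<Sum>k=1..N. F i j k) = (\<Sum>k=1..N. \<Sum>i=1..N. \<Sum>j=1..N. F i j k)"
proof -
  have "(\<Sum>i=1..N. \<Sum>j=1..N. \<Sum>k=1..N. F i j k) = (\<Sum>i=1..N. \<Sum>k=1..N. \<Sum>j=1..N. F i j k)"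
    by (rule sum.cong[OF refl], rule sum.swap)
  also have "\<dots> = (\<Sum>k=1..N. \<Sum>i=1..N. \<Sum>j=1..N. F i j k)"
    by (rule sum.swap)
  finally show ?thesis .
qed

text \<open>Permuting the arguments makes the normal index the first one, so directional facts have
  to be proved only for \<open>inner_x\<close>.\<close>

lemma inner_y_eq_inner_x:
  "inner_y h N f g = inner_x h N (\<lambda>i j k. f j i k) (\<lambda>i j k. g j i k)"
  unfolding inner_x_def inner_y_def by (subst sum.swap) simp

lemma inner_z_eq_inner_x:
  "inner_z h N f g = inner_x h N (\<lambda>i j k. f j k i) (\<lambda>i j k. g j k i)"
  unfolding inner_x_def inner_z_def by (subst sum3_rotate) simp

lemma inner_x_nonneg:
  assumes "h > 0"
  shows "inner_x h N f f \<ge> 0"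
  unfolding inner_x_def
  by (intro mult_nonneg_nonneg[of "1 / 2 * h ^ 3"] sum_nonneg add_nonneg_nonneg zero_le_square)
     (use assms in auto)

lemma face_norm_sq: "h > 0 \<Longrightarrow> (face_norm h N f)\<^sup>2 = face_inner h N f f"
  by (simp add: face_norm_def face_inner_def inner_y_eq_inner_x inner_z_eq_inner_x inner_x_nonneg)

text \<open>Sums the pointwise identity 2a(a - b) = a^2 - b^2 + (a - b)^2. Applied to gradients, it
  yields the energy difference plus the numerical dissipation of an implicit step.\<close>

lemma inner_x_polarization:
  "2 * inner_x h N f (\<lambda>i j k. f i j k - g i j k)
     = inner_x h N f f - inner_x h N g g
       + inner_x h N (\<lambda>i j k. f i j k - g i j k) (\<lambda>i j k. f i j k - g i j k)"
proof -
  let ?S = "\<lambda>f g :: grid. \<Sum>i=1..N. \<Sum>j=1..N. \<Sum>k=1..N.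
    f i j k * g i j k + f (i - 1) j k * g (i - 1) j k"
  let ?d = "\<lambda>i j k. f i j k - g i j k"
  have "2 * ?S f ?d = (\<Sum>i=1..N. \<Sum>j=1..N. \<Sum>k=1..N.
      (f i j k * f i j k + f (i - 1) j k * f (i - 1) j k)
      - (g i j k * g i j k + g (i - 1) j k * g (i - 1) j k)
      + (?d i j k * ?d i j k + ?d (i - 1) j k * ?d (i - 1) j k))"
    unfolding sum_distrib_left by (intro sum.cong refl) (simp add: algebra_simps)
  also have "\<dots> = ?S f f - ?S g g + ?S ?d ?d"
    by (simp only: sum.distrib sum_subtractf)
  finally have "2 * ?S f ?d = ?S f f - ?S g g + ?S ?d ?d" .
  moreover have "2 * (c * x) = c * y - c * z + c * w" if "2 * x = y - z + w" for c x y z w :: real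
    using that by algebra
  ultimately show ?thesis
    unfolding inner_x_def by blast
qed

lemma inner_grad_polarization:
  "2 * face_inner h N (grad h \<phi>) (grad h (\<lambda>i j k. \<phi> i j k - \<psi> i j k))
     = face_inner h N (grad h \<phi>) (grad h \<phi>) - face_inner h N (grad h \<psi>) (grad h \<psi>)
       + face_inner h N (grad h (\<lambda>i j k. \<phi> i j k - \<psi> i j k))
                        (grad h (\<lambda>i j k. \<phi> i j k - \<psi> i j k))"
proof -
  have "Dx h (\<lambda>i j k. \<phi> i j k - \<psi> i j k) = (\<lambda>i j k. Dx h \<phi> i j k - Dx h \<psi> i j k)"
    "Dy h (\<lambda>i j k. \<phi> i j k - \<psi> i j k) = (\<lambda>i j k. Dy h \<phi> i j k - Dy h \<psi> i j k)"
    "Dz h (\<lambda>i j k. \<phi> i j k - \<psi> i j k) = (\<lambda>i j k. Dz h \<phi> i j k - Dz h \<psi> i j k)"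
    by (simp_all add: fun_eq_iff Dx_def Dy_def Dz_def diff_divide_distrib)
  then show ?thesis
    by (simp add: face_inner_def grad_def inner_y_eq_inner_x inner_z_eq_inner_x
        distrib_left inner_x_polarization)
qed

lemma face_inner_commute: "face_inner h N f g = face_inner h N g f"
  by (simp add: face_inner_def inner_x_def inner_y_def inner_z_def mult.commute)

text \<open>Multiplication by a fixed field is symmetric, so the coupling terms of the transport and
  Stokes equations become the same number.\<close>

lemma face_inner_mult_assoc:
  "face_inner h N (face_mult a f) g = face_inner h N f (face_mult a g)"
  by (simp add: face_inner_def face_mult_def inner_x_def inner_y_def inner_z_def mult_ac)

section \<open>Summation by parts\<close>

text \<open>Adding twice the divergence sum makes everything telescope. The factor 2 arises because
  both faces of each cell are counted; it cancels the 1/2 in \<open>inner_x\<close>.\<close>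

lemma sum_by_parts_1d:
  fixes a f :: "nat \<Rightarrow> real"
  assumes "f 0 = 0" "f N = 0"
  shows "(\<Sum>i=1..N. f i * (a (i + 1) - a i) + f (i - 1) * (a (i - 1 + 1) - a (i - 1)))
           = - 2 * (\<Sum>i=1..N. a i * (f i - f (i - 1)))"
proof -
  \<comment> \<open>The boundary terms are kept for general \<open>n\<close>, since \<open>f\<close>
    vanishes only at \<open>0\<close> and \<open>N\<close> and the induction passes through all
    values between.\<close>
  have "(\<Sum>i=1..n. f i * (a (i + 1) - a i) + f (i - 1) * (a (i - 1 + 1) - a (i - 1)))
      + 2 * (\<Sum>i=1..n. a i * (f i - f (i - 1)))
      = f n * (a (n + 1) + a n) - f 0 * (a 1 + a 0)" for n
    by (induction n) (auto simp: algebra_simps)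
  from this[of N] show ?thesis
    using assms by simp
qed

text \<open>The one-dimensional identity holds on each grid line in the x direction, once the normal
  index is summed innermost.\<close>

lemma sum_by_parts_x:
  assumes "\<forall>j\<in>{1..N}. \<forall>k\<in>{1..N}. f 0 j k = 0 \<and> f N j k = 0"
  shows "inner_x h N f (Dx h \<phi>)
           = - (h ^ 3 * (\<Sum>i=1..N. \<Sum>j=1..N. \<Sum>k=1..N. \<phi> i j k * ((f i j k - f (i - 1) j k) / h)))"
proof -
  have "(\<Sum>i=1..N. \<Sum>j=1..N. \<Sum>k=1..N.
           f i j k * Dx h \<phi> i j k + f (i - 1) j k * Dx h \<phi> (i - 1) j k)
      = (\<Sum>j=1..N. \<Sum>k=1..N. \<Sum>i=1..N.
           f i j k * Dx h \<phi> i j k + f (i - 1) j k * Dx h \<phi> (i - 1) j k)"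
    by (rule sum3_rotate[symmetric])
  also have "\<dots> = (\<Sum>j=1..N. \<Sum>k=1..N. - 2 * (\<Sum>i=1..N. \<phi> i j k * ((f i j k - f (i - 1) j k) / h)))"
  proof (intro sum.cong refl)
    fix j k assume "j \<in> {1..N}" "k \<in> {1..N}"
    then have "(\<Sum>i=1..N. f i j k * (\<phi> (i + 1) j k - \<phi> i j k)
                 + f (i - 1) j k * (\<phi> (i - 1 + 1) j k - \<phi> (i - 1) j k)) / h
        = - 2 * (\<Sum>i=1..N. \<phi> i j k * (f i j k - f (i - 1) j k)) / h"
      using assms sum_by_parts_1d[of "\<lambda>i. f i j k" N "\<lambda>i. \<phi> i j k"] by simp
    then show "(\<Sum>i=1..N. f i j k * Dx h \<phi> i j k + f (i - 1) j k * Dx h \<phi> (i - 1) j k)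
        = - 2 * (\<Sum>i=1..N. \<phi> i j k * ((f i j k - f (i - 1) j k) / h))"
      by (simp add: Dx_def sum_divide_distrib add_divide_distrib sum_distrib_left)
  qed
  also have "\<dots> = - 2 * (\<Sum>j=1..N. \<Sum>k=1..N. \<Sum>i=1..N. \<phi> i j k * ((f i j k - f (i - 1) j k) / h))"
    by (simp only: sum_distrib_left)
  also have "\<dots> = - 2 * (\<Sum>i=1..N. \<Sum>j=1..N. \<Sum>k=1..N. \<phi> i j k * ((f i j k - f (i - 1) j k) / h))"
    by (simp only: sum3_rotate[of "\<lambda>j k i. \<phi> i j k * ((f i j k - f (i - 1) j k) / h)"])
  finally show ?thesis
    by (simp add: inner_x_def)
qed

lemma summation_by_parts:
  assumes "no_penetration N f"
  shows "face_inner h N f (grad h \<phi>) = - cell_inner h N \<phi> (div_h h f)"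
proof -
  have x: "inner_x h N (fx f) (Dx h \<phi>)
      = - (h ^ 3 * (\<Sum>i=1..N. \<Sum>j=1..N. \<Sum>k=1..N. \<phi> i j k * ((fx f i j k - fx f (i - 1) j k) / h)))"
    using assms by (intro sum_by_parts_x) (simp add: no_penetration_def)
  have "inner_y h N (fy f) (Dy h \<phi>)
      = inner_x h N (\<lambda>i j k. fy f j i k) (Dx h (\<lambda>i j k. \<phi> j i k))"
    by (simp add: inner_y_eq_inner_x Dx_def Dy_def inner_x_def)
  also have "\<dots> = - (h ^ 3 * (\<Sum>j=1..N. \<Sum>i=1..N. \<Sum>k=1..N. \<phi> i j k * ((fy f i j k - fy f i (j - 1) k) / h)))"
    using assms by (intro sum_by_parts_x) (simp add: no_penetration_def)
  also have "\<dots> = - (h ^ 3 * (\<Sum>i=1..N. \<Sum>j=1..N. \<Sum>k=1..N. \<phi> i j k * ((fy f i j k - fy f i (j - 1) k) / h)))"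
    by (subst sum.swap) simp
  finally have y: "inner_y h N (fy f) (Dy h \<phi>) = \<dots>" .
  have "inner_z h N (fz f) (Dz h \<phi>)
      = inner_x h N (\<lambda>i j k. fz f j k i) (Dx h (\<lambda>i j k. \<phi> j k i))"
    by (simp add: inner_z_eq_inner_x Dx_def Dz_def inner_x_def)
  also have "\<dots> = - (h ^ 3 * (\<Sum>k=1..N. \<Sum>i=1..N. \<Sum>j=1..N. \<phi> i j k * ((fz f i j k - fz f i j (k - 1)) / h)))"
    using assms by (intro sum_by_parts_x) (simp add: no_penetration_def)
  also have "\<dots> = - (h ^ 3 * (\<Sum>i=1..N. \<Sum>j=1..N. \<Sum>k=1..N. \<phi> i j k * ((fz f i j k - fz f i j (k - 1)) / h)))"
    by (subst sum3_rotate) simp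
  finally have z: "inner_z h N (fz f) (Dz h \<phi>) = \<dots>" .
  show ?thesis
    unfolding face_inner_def grad_def face_field.sel x y z
    by (simp add: cell_inner_def div_h_def distrib_left sum.distrib)
qed

text \<open>A ghost value equal to its interior neighbour makes the normal difference at the
  boundary face vanish, so gradients are admissible in \<open>summation_by_parts\<close>.\<close>

lemma no_penetration_grad: "neumann N \<phi> \<Longrightarrow> no_penetration N (grad h \<phi>)"
  by (simp add: neumann_def no_penetration_def grad_def Dx_def Dy_def Dz_def)

lemma no_penetration_face_mult: "no_penetration N f \<Longrightarrow> no_penetration N (face_mult a f)"
  by (simp add: no_penetration_def face_mult_def)

section \<open>The energy estimate\<close>

text \<open>The equation covers the interior faces, and the test function \<open>u\<close> vanishes
  on the others. The grids \<open>l\<close>, \<open>q\<close>, \<open>r\<close> are arbitrary so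
  that the permuted y and z components fit too.\<close>

lemma inner_x_stokes_test:
  assumes eq: "\<forall>i\<in>{1..<N}. \<forall>j\<in>{1..N}. \<forall>k\<in>{1..N}.
      - l i j k + u i j k + q i j k + \<gamma> * r i j k = 0"
    and bdry: "\<forall>j\<in>{1..N}. \<forall>k\<in>{1..N}. u 0 j k = 0 \<and> u N j k = 0"
  shows "- inner_x h N l u + inner_x h N u u + inner_x h N q u + \<gamma> * inner_x h N r u = 0"
proof -
  \<comment> \<open>The face index includes 0, because the shifted terms at \<open>i - 1\<close>
    reach it.\<close>
  have pt: "(- l i j k + u i j k + q i j k + \<gamma> * r i j k) * u i j k = 0"
    if "i \<le> N" "j \<in> {1..N}" "k \<in> {1..N}" for i j k
  proof (cases "i = 0 \<or> i = N")
    case True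
    then show ?thesis using bdry that by auto
  next
    case False
    then have "i \<in> {1..<N}" using that by simp
    then show ?thesis using eq that by simp
  qed
  have "- inner_x h N l u + inner_x h N u u + inner_x h N q u + \<gamma> * inner_x h N r u
      = 1 / 2 * h ^ 3 * (\<Sum>i=1..N. \<Sum>j=1..N. \<Sum>k=1..N.
          (- l i j k + u i j k + q i j k + \<gamma> * r i j k) * u i j k
        + (- l (i - 1) j k + u (i - 1) j k + q (i - 1) j k + \<gamma> * r (i - 1) j k) * u (i - 1) j k)"
    unfolding inner_x_def
    by (simp add: sum_distrib_left algebra_simps sum.distrib sum_subtractf sum_negf)
  also have "\<dots> = 1 / 2 * h ^ 3 * (\<Sum>i=1..N. \<Sum>j=1..N. \<Sum>k=1..N. 0 + 0)"
  proof (intro arg_cong[where f = "\<lambda>x. 1 / 2 * h ^ 3 * x"] sum.cong refl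
      arg_cong2[where f = "(+)"])
    fix i j k assume "i \<in> {1..N}" "j \<in> {1..N}" "k \<in> {1..N}"
    then show "(- l i j k + u i j k + q i j k + \<gamma> * r i j k) * u i j k = 0"
      "(- l (i - 1) j k + u (i - 1) j k + q (i - 1) j k + \<gamma> * r (i - 1) j k) * u (i - 1) j k = 0"
      by (intro pt; auto)+
  qed
  also have "\<dots> = 0"
    by simp
  finally show ?thesis .
qed

text \<open>The potential is convex with derivative \<open>ln (1 + x) - ln (1 - x)\<close>, so its
  tangent at \<open>a\<close> lies below its value at \<open>b\<close>.\<close>

lemma log_potential_tangent:
  fixes a b :: real
  assumes "-1 < a" "a < 1" "-1 < b" "b < 1"
  shows "((1 + a) * ln (1 + a) + (1 - a) * ln (1 - a))
           - ((1 + b) * ln (1 + b) + (1 - b) * ln (1 - b))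
         \<le> (a - b) * (ln (1 + a) - ln (1 - a))"
proof -
  have *: "y * (ln x - ln y) \<le> x - y" if "x > 0" "y > 0" for x y :: real
  proof -
    have "ln x - ln y \<le> x / y - 1"
      using that ln_le_minus_one[of "x / y"] by (simp add: ln_div)
    then have "y * (ln x - ln y) \<le> y * (x / y - 1)"
      using that by (intro mult_left_mono) auto
    also have "\<dots> = x - y" using that by (simp add: field_simps)
    finally show ?thesis .
  qed
  \<comment> \<open>The two upper bounds, a - b and b - a, cancel on adding.\<close>
  show ?thesis
    using *[of "1 + a" "1 + b"] *[of "1 - a" "1 - b"] assms by (simp add: algebra_simps)
qed

theorem theorem3p2:
  fixes \<gamma> \<epsilon> \<theta>\<^sub>0 L h s :: real and N :: nat
    and \<phi> \<phi>' \<mu> p :: grid and u :: face_field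
  assumes "\<gamma> > 0" and "\<epsilon> > 0" and "\<theta>\<^sub>0 > 0" and "L > 0" and "N > 0" and "h = L / real N"
    and "s > 0"
    and "neumann N \<phi>" and "neumann N \<phi>'" and "neumann N \<mu>" and "neumann N p"
    and "no_penetration N u" and "free_slip N u"
    and "\<forall>i\<in>{1..N}. \<forall>j\<in>{1..N}. \<forall>k\<in>{1..N}. -1 < \<phi> i j k \<and> \<phi> i j k < 1"
    and "\<forall>i\<in>{1..N}. \<forall>j\<in>{1..N}. \<forall>k\<in>{1..N}. -1 < \<phi>' i j k \<and> \<phi>' i j k < 1"
    and "\<forall>i\<in>{1..N}. \<forall>j\<in>{1..N}. \<forall>k\<in>{1..N}.
           \<phi>' i j k - \<phi> i j k
             = s * lap_cell h \<mu> i j k - s * div_h h (face_mult (avg \<phi>) u) i j k"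
    and "\<forall>i\<in>{1..N}. \<forall>j\<in>{1..N}. \<forall>k\<in>{1..N}.
           \<mu> i j k = ln (1 + \<phi>' i j k) - ln (1 - \<phi>' i j k) - \<theta>\<^sub>0 * \<phi> i j k
                      - \<epsilon>\<^sup>2 * lap_cell h \<phi>' i j k"
    and "\<forall>i\<in>{1..<N}. \<forall>j\<in>{1..N}. \<forall>k\<in>{1..N}.
           - fx (lap_face h u) i j k + fx u i j k + fx (grad h p) i j k
             + \<gamma> * fx (face_mult (avg \<phi>) (grad h \<mu>)) i j k = 0"
    and "\<forall>i\<in>{1..N}. \<forall>j\<in>{1..<N}. \<forall>k\<in>{1..N}.
           - fy (lap_face h u) i j k + fy u i j k + fy (grad h p) i j k
             + \<gamma> * fy (face_mult (avg \<phi>) (grad h \<mu>)) i j k = 0"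
    and "\<forall>i\<in>{1..N}. \<forall>j\<in>{1..N}. \<forall>k\<in>{1..<N}.
           - fz (lap_face h u) i j k + fz u i j k + fz (grad h p) i j k
             + \<gamma> * fz (face_mult (avg \<phi>) (grad h \<mu>)) i j k = 0"
    and "\<forall>i\<in>{1..N}. \<forall>j\<in>{1..N}. \<forall>k\<in>{1..N}. div_h h u i j k = 0"
  shows "energy \<epsilon> \<theta>\<^sub>0 h N \<phi>' - energy \<epsilon> \<theta>\<^sub>0 h N \<phi>
           \<le> - (\<epsilon>\<^sup>2 / 2) * (face_norm h N (grad h (\<lambda>i j k. \<phi>' i j k - \<phi> i j k)))\<^sup>2
             - s * (face_norm h N (grad h \<mu>))\<^sup>2
             - s / \<gamma> * ((face_norm h N u)\<^sup>2 + grad_norm_sq h N u)"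
proof -
  note h_eq = assms(6) and bc = assms(8-12)
  have h: "h > 0" using assms(4,5) h_eq by simp
  define \<psi> where "\<psi> = (\<lambda>i j k. \<phi>' i j k - \<phi> i j k)"
  define W where "W = face_inner h N u u + grad_norm_sq h N u"

  \<comment> \<open>Stokes equation tested with the velocity\<close>
  have "face_inner h N u (grad h p) = - cell_inner h N p (div_h h u)"
    using bc(5) by (rule summation_by_parts)
  also have "\<dots> = 0"
    using assms(21) by (simp add: cell_inner_def)
  finally have pressure: "face_inner h N (grad h p) u = 0"
    by (simp add: face_inner_commute)

  let ?c = "face_mult (avg \<phi>) (grad h \<mu>)"
  have "- inner_x h N (fx (lap_face h u)) (fx u) + inner_x h N (fx u) (fx u)
      + inner_x h N (fx (grad h p)) (fx u) + \<gamma> * inner_x h N (fx ?c) (fx u) = 0"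
    using assms(18) bc(5) by (intro inner_x_stokes_test) (auto simp: no_penetration_def)
  moreover have "- inner_y h N (fy (lap_face h u)) (fy u) + inner_y h N (fy u) (fy u)
      + inner_y h N (fy (grad h p)) (fy u) + \<gamma> * inner_y h N (fy ?c) (fy u) = 0"
    unfolding inner_y_eq_inner_x
    using assms(19) bc(5) by (intro inner_x_stokes_test) (auto simp: no_penetration_def)
  moreover have "- inner_z h N (fz (lap_face h u)) (fz u) + inner_z h N (fz u) (fz u)
      + inner_z h N (fz (grad h p)) (fz u) + \<gamma> * inner_z h N (fz ?c) (fz u) = 0"
    unfolding inner_z_eq_inner_x
    using assms(20) bc(5) by (intro inner_x_stokes_test) (auto simp: no_penetration_def)
  \<comment> \<open>The viscous term is \<open>grad_norm_sq\<close> by definition, so it enters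
    \<open>W\<close> directly.\<close>
  ultimately have "W + face_inner h N (grad h p) u + \<gamma> * face_inner h N ?c u = 0"
    unfolding W_def grad_norm_sq_def face_inner_def distrib_left by linarith
  \<comment> \<open>The average of \<phi> moves from the gradient of \<mu> to \<open>u\<close>,
    which gives the flux of the transport equation.\<close>
  then have "\<gamma> * face_inner h N (face_mult (avg \<phi>) u) (grad h \<mu>) = - W"
    using pressure by (simp add: face_inner_mult_assoc face_inner_commute[of h N u])
  then have coupling: "face_inner h N (face_mult (avg \<phi>) u) (grad h \<mu>) = - W / \<gamma>"
    using assms(1) by (simp add: field_simps)

  \<comment> \<open>Transport equation tested with the chemical potential\<close>
  have rate: "\<psi> i j k = s * lap_cell h \<mu> i j k - s * div_h h (face_mult (avg \<phi>) u) i j k"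
    if "i \<in> {1..N}" "j \<in> {1..N}" "k \<in> {1..N}" for i j k
    using assms(16) that by (simp add: \<psi>_def)
  have "cell_inner h N \<mu> \<psi>
      = cell_inner h N \<mu> (\<lambda>i j k. s * lap_cell h \<mu> i j k - s * div_h h (face_mult (avg \<phi>) u) i j k)"
    by (simp only: cell_inner_def rate cong: sum.cong)
  also have "\<dots> = s * cell_inner h N \<mu> (lap_cell h \<mu>)
      - s * cell_inner h N \<mu> (div_h h (face_mult (avg \<phi>) u))"
    by (simp add: cell_inner_def sum_distrib_left sum_subtractf algebra_simps)
  \<comment> \<open>Both fluxes have zero normal part on the boundary: the gradient by the Neumann
    condition, the advective flux because \<open>u\<close> does.\<close>
  also have "\<dots> = - s * face_inner h N (grad h \<mu>) (grad h \<mu>)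
      + s * face_inner h N (face_mult (avg \<phi>) u) (grad h \<mu>)"
    using bc by (simp add: summation_by_parts no_penetration_grad no_penetration_face_mult lap_cell_def)
  finally have dissipation:
    "cell_inner h N \<mu> \<psi> = - s * face_inner h N (grad h \<mu>) (grad h \<mu>) - s / \<gamma> * W"
    by (simp add: coupling)

  \<comment> \<open>Convex-concave splitting of the energy\<close>
  let ?G = "\<lambda>\<phi> :: grid. \<lambda>i j k. (1 + \<phi> i j k) * ln (1 + \<phi> i j k)
    + (1 - \<phi> i j k) * ln (1 - \<phi> i j k) - \<theta>\<^sub>0 / 2 * (\<phi> i j k)\<^sup>2"
  \<comment> \<open>Adding back the Laplacian term leaves the pointwise part of \<mu>: the slope of
    the convex part at the new value plus that of the concave part at the old one.\<close>
  have pt: "?G \<phi>' i j k - ?G \<phi> i j k \<le> (\<mu> i j k + \<epsilon>\<^sup>2 * lap_cell h \<phi>' i j k) * \<psi> i j k"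
    if "i \<in> {1..N}" "j \<in> {1..N}" "k \<in> {1..N}" for i j k
  proof -
    \<comment> \<open>Half of this square is the gap between the concave quadratic and its tangent
      at the old value.\<close>
    have "\<theta>\<^sub>0 * (\<phi>' i j k - \<phi> i j k)\<^sup>2 \<ge> 0"
      using assms(3) by simp
    then have "- (\<theta>\<^sub>0 / 2 * (\<phi>' i j k)\<^sup>2) + \<theta>\<^sub>0 / 2 * (\<phi> i j k)\<^sup>2
        \<le> \<psi> i j k * (- \<theta>\<^sub>0 * \<phi> i j k)"
      by (simp add: \<psi>_def power2_eq_square algebra_simps)
    moreover have "(1 + \<phi>' i j k) * ln (1 + \<phi>' i j k) + (1 - \<phi>' i j k) * ln (1 - \<phi>' i j k)
        - ((1 + \<phi> i j k) * ln (1 + \<phi> i j k) + (1 - \<phi> i j k) * ln (1 - \<phi> i j k))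
        \<le> \<psi> i j k * (ln (1 + \<phi>' i j k) - ln (1 - \<phi>' i j k))"
      unfolding \<psi>_def using assms(14,15) that by (intro log_potential_tangent) auto
    moreover have "\<mu> i j k + \<epsilon>\<^sup>2 * lap_cell h \<phi>' i j k
        = (ln (1 + \<phi>' i j k) - ln (1 - \<phi>' i j k)) + - \<theta>\<^sub>0 * \<phi> i j k"
      using assms(17) that by simp
    then have "(\<mu> i j k + \<epsilon>\<^sup>2 * lap_cell h \<phi>' i j k) * \<psi> i j k
        = \<psi> i j k * (ln (1 + \<phi>' i j k) - ln (1 - \<phi>' i j k)) + \<psi> i j k * (- \<theta>\<^sub>0 * \<phi> i j k)"
      by (simp only: mult.commute distrib_left)
    ultimately show ?thesis
      by linarith
  qed
  have "cell_inner h N (?G \<phi>') (\<lambda>i j k. 1) - cell_inner h N (?G \<phi>) (\<lambda>i j k. 1)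
      = h ^ 3 * (\<Sum>i=1..N. \<Sum>j=1..N. \<Sum>k=1..N. ?G \<phi>' i j k - ?G \<phi> i j k)"
    by (simp only: cell_inner_def mult_1_right sum_subtractf right_diff_distrib)
  also have "\<dots> \<le> h ^ 3 * (\<Sum>i=1..N. \<Sum>j=1..N. \<Sum>k=1..N.
      (\<mu> i j k + \<epsilon>\<^sup>2 * lap_cell h \<phi>' i j k) * \<psi> i j k)"
    using h pt by (intro mult_left_mono sum_mono) auto
  also have "\<dots> = cell_inner h N \<mu> \<psi> + \<epsilon>\<^sup>2 * cell_inner h N \<psi> (lap_cell h \<phi>')"
    by (simp add: cell_inner_def sum_distrib_left sum.distrib algebra_simps)
  \<comment> \<open>Here the Neumann condition on \<phi>' removes the boundary terms.\<close>
  also have "cell_inner h N \<psi> (lap_cell h \<phi>') = - face_inner h N (grad h \<phi>') (grad h \<psi>)"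
    using bc by (simp add: summation_by_parts no_penetration_grad lap_cell_def)
  finally have potential:
    "cell_inner h N (?G \<phi>') (\<lambda>i j k. 1) - cell_inner h N (?G \<phi>) (\<lambda>i j k. 1)
      \<le> cell_inner h N \<mu> \<psi> - \<epsilon>\<^sup>2 / 2 * (2 * face_inner h N (grad h \<phi>') (grad h \<psi>))"
    by simp
  show ?thesis
    \<comment> \<open>Polarization of the doubled product supplies the gradient energies and the
      extra square of the gradient of \<psi>.\<close>
    using potential dissipation
    unfolding energy_def face_norm_sq[OF h] \<psi>_def inner_grad_polarization W_def
    unfolding distrib_left right_diff_distrib by linarith
qed

end
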